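(* Let $V^h$, $(\cdot,\cdot)$, $\|\cdot\|$, $A$, $\delta>0$ be as in the context, so that $A=A^*\ge\delta I$ on $V^h$. Let $T>0$, $N\in\mathbb{N}$, $N\ge 1$, $\tau=T/N$, and let $\phi,\psi\in V^h$. Let $(w_n)_{n=-1}^{N}\subset V^h$ and $\varphi\in V^h$ be the solution of the discrete inverse problem $$\frac{w_{n+1}-w_n}{\tau}+Aw_{n+1}=\varphi,\quad n=-1,0,\dots,N-1,\qquad w_0=\phi,\qquad w_N=\psi.$$ Given an arbitrary $\varphi^0\in V^h$, define iterates for $k=0,1,\dots$ as follows: given $\varphi^k$, the sequence $(w_n^k)_{n=-1}^{N}\subset V^h$ is the solution of $$\frac{w_{n+1}^{k}-w_n^{k}}{\tau}+Aw_{n+1}^{k}=\varphi^{k},\quad n=-1,0,\dots,N-1,\qquad w_0^{k}=\phi,$$ and $$\varphi^{k+1}=\frac{w_N^{k}-w_{N-1}^{k}}{\tau}+A\psi .$$ Then the iterative process converges linearly with speed $$\bar\varrho=(1+\tau\delta)^{-N},$$ and for all $k=0,1,\dots$ the following estimate holds: $$\|\varphi^{k+1}-\varphi\|\le\bar\varrho\,\|\varphi^{k}-\varphi\|.$$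
   Context: Let $\Omega\subset\mathbb{R}^2$ be a bounded polygon, $(u,v)=\int_\Omega uv\,d\boldsymbol{x}$ and $\|u\|=(u,u)^{1/2}$ the $L_2(\Omega)$ scalar product and norm. Let $k,c$ be functions on $\Omega$ with $0<k_1\le k(\boldsymbol{x})\le k_2$, $c(\boldsymbol{x})\ge 0$, and $\mu$ a function on $\partial\Omega$ with $\mu(\boldsymbol{x})\ge\mu_1>0$, and let $$a(u,v)=\int_\Omega\left(k\,\mathrm{grad}\,u\cdot\mathrm{grad}\,v+c\,uv\right)d\boldsymbol{x}+\int_{\partial\Omega}\mu\,uv\,d\boldsymbol{x}$$ (assumed well defined). $V^h\subset H^1(\Omega)$ is a finite-dimensional (finite element) subspace with the $L_2(\Omega)$ scalar product, and $A:V^h\to V^h$ is defined by $(Ay,v)=a(y,v)$ for all $y,v\in V^h$. Here $\delta>0$ is a constant with $a(u,u)\ge\delta\|u\|^2$, so $A=A^*\ge\delta I$ on $V^h$, where $I$ is the identity operator. The time grid is the expanded uniform grid $t_n=n\tau$, $n=-1,0,\dots,N$, $\tau N=T$; the equation for $n=-1$ together with the condition at $n=0$ determines the value at $n=-1$. The inverse problem is assumed to be well-posed. *)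

theory Defs
  imports "HOL-Analysis.Analysis"
begin
fun polygonal_path :: "(real^2) list \<Rightarrow> real \<Rightarrow> real^2" where
  "polygonal_path (a # b # c # vs) = linepath a b +++ polygonal_path (b # c # vs)"
| "polygonal_path [a, b] = linepath a b"
| "polygonal_path [a] = linepath a a"
| "polygonal_path [] = linepath 0 0"

definition polygon_boundary :: "(real^2) list \<Rightarrow> real \<Rightarrow> real^2" where
  "polygon_boundary vs = polygonal_path (vs @ [hd vs])"

text \<open>A polygon is given by the cyclic list of its vertices.  The boundary path is always closed,
  so simplicity makes it a Jordan curve (and rules out lists with fewer than three vertices).\<close>

definition simple_polygon :: "(real^2) list \<Rightarrow> bool" where
  "simple_polygon vs \<longleftrightarrow> vs \<noteq> [] \<and> simple_path (polygon_boundary vs)"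

definition polygon :: "(real^2) list \<Rightarrow> (real^2) set" where
  "polygon vs = inside (path_image (polygon_boundary vs))"

definition edge :: "(real^2) list \<Rightarrow> nat \<Rightarrow> real \<Rightarrow> real^2" where
  "edge vs i = linepath (vs ! i) (vs ! (Suc i mod length vs))"

definition edge_length :: "(real^2) list \<Rightarrow> nat \<Rightarrow> real" where
  "edge_length vs i = dist (vs ! i) (vs ! (Suc i mod length vs))"

definition sq_integrable :: "'a measure \<Rightarrow> ('a \<Rightarrow> 'b::euclidean_space) \<Rightarrow> bool" where
  "sq_integrable M f \<longleftrightarrow> f \<in> borel_measurable M \<and> integrable M (\<lambda>x. (norm (f x))\<^sup>2)"

text \<open>Integration over the boundary with respect to arc length, edge by edge: each edge is
  parametrised over the unit interval with constant speed, its length.\<close>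

definition bd_integrable :: "(real^2) list \<Rightarrow> (real^2 \<Rightarrow> real) \<Rightarrow> bool" where
  "bd_integrable vs f \<longleftrightarrow>
     (\<forall>i<length vs. integrable (lebesgue_on {0..1}) (\<lambda>t. f (edge vs i t)))"

definition bd_sq_integrable :: "(real^2) list \<Rightarrow> (real^2 \<Rightarrow> real) \<Rightarrow> bool" where
  "bd_sq_integrable vs f \<longleftrightarrow>
     (\<forall>i<length vs. sq_integrable (lebesgue_on {0..1}) (\<lambda>t. f (edge vs i t)))"

definition bd_integral :: "(real^2) list \<Rightarrow> (real^2 \<Rightarrow> real) \<Rightarrow> real" where
  "bd_integral vs f =
     (\<Sum>i<length vs. edge_length vs i * (\<integral>t. f (edge vs i t) \<partial>lebesgue_on {0..1}))"

definition partial_deriv :: "real^2 \<Rightarrow> (real^2 \<Rightarrow> real) \<Rightarrow> real^2 \<Rightarrow> real" where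
  "partial_deriv b f x = frechet_derivative f (at x) b"

definition grad :: "(real^2 \<Rightarrow> real) \<Rightarrow> real^2 \<Rightarrow> real^2" where
  "grad f x = (\<Sum>b\<in>Basis. partial_deriv b f x *\<^sub>R b)"

primrec Ck :: "nat \<Rightarrow> (real^2 \<Rightarrow> real) \<Rightarrow> bool" where
  "Ck 0 f = continuous_on UNIV f"
| "Ck (Suc n) f = ((\<forall>x. f differentiable (at x)) \<and> (\<forall>b\<in>Basis. Ck n (partial_deriv b f)))"

definition smooth :: "(real^2 \<Rightarrow> real) \<Rightarrow> bool" where
  "smooth f \<longleftrightarrow> (\<forall>n. Ck n f)"

definition test_function :: "(real^2) set \<Rightarrow> (real^2 \<Rightarrow> real) \<Rightarrow> bool" where
  "test_function \<Omega> p \<longleftrightarrow> smooth p \<and> compact (closure {x. p x \<noteq> 0}) \<and> closure {x. p x \<noteq> 0} \<subseteq> \<Omega>"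

definition has_weak_grad :: "(real^2) set \<Rightarrow> (real^2 \<Rightarrow> real) \<Rightarrow> (real^2 \<Rightarrow> real^2) \<Rightarrow> bool" where
  "has_weak_grad \<Omega> u G \<longleftrightarrow>
     sq_integrable (lebesgue_on \<Omega>) u \<and> sq_integrable (lebesgue_on \<Omega>) G \<and>
     (\<forall>p. test_function \<Omega> p \<longrightarrow> (\<forall>b\<in>Basis.
        (\<integral>x. u x * partial_deriv b p x \<partial>lebesgue_on \<Omega>) =
          - (\<integral>x. (G x \<bullet> b) * p x \<partial>lebesgue_on \<Omega>)))"

definition H1 :: "(real^2) set \<Rightarrow> (real^2 \<Rightarrow> real) set" where
  "H1 \<Omega> = {u. \<exists>G. has_weak_grad \<Omega> u G}"

text \<open>Boundary values in the sense of traces: \<open>g\<close> is the \<open>L\<^sub>2\<close> limit on the boundary of the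
  restrictions of smooth functions converging to \<open>u\<close> in the Sobolev norm.\<close>

definition has_trace :: "(real^2) list \<Rightarrow> (real^2 \<Rightarrow> real) \<Rightarrow> (real^2 \<Rightarrow> real) \<Rightarrow> bool" where
  "has_trace vs u g \<longleftrightarrow> bd_sq_integrable vs g \<and>
     (\<exists>G s. has_weak_grad (polygon vs) u G \<and> (\<forall>j::nat. smooth (s j)) \<and>
        (\<lambda>j. \<integral>x. (s j x - u x)\<^sup>2 \<partial>lebesgue_on (polygon vs)) \<longlonglongrightarrow> 0 \<and>
        (\<lambda>j. \<integral>x. (norm (grad (s j) x - G x))\<^sup>2 \<partial>lebesgue_on (polygon vs)) \<longlonglongrightarrow> 0 \<and>
        (\<lambda>j. bd_integral vs (\<lambda>x. (s j x - g x)\<^sup>2)) \<longlonglongrightarrow> 0)"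

definition weak_grad :: "(real^2) set \<Rightarrow> (real^2 \<Rightarrow> real) \<Rightarrow> real^2 \<Rightarrow> real^2" where
  "weak_grad \<Omega> u = (SOME G. has_weak_grad \<Omega> u G)"

definition bd_trace :: "(real^2) list \<Rightarrow> (real^2 \<Rightarrow> real) \<Rightarrow> real^2 \<Rightarrow> real" where
  "bd_trace vs u = (SOME g. has_trace vs u g)"

text \<open>Elements of \<open>L\<^sub>2(\<Omega>)\<close> are represented by functions; equality of elements is equality almost
  everywhere on \<open>\<Omega>\<close>.\<close>

definition ae_eq :: "(real^2) set \<Rightarrow> (real^2 \<Rightarrow> real) \<Rightarrow> (real^2 \<Rightarrow> real) \<Rightarrow> bool" where
  "ae_eq \<Omega> u v \<longleftrightarrow> (AE x in lebesgue_on \<Omega>. u x = v x)"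

definition l2_inner :: "(real^2) set \<Rightarrow> (real^2 \<Rightarrow> real) \<Rightarrow> (real^2 \<Rightarrow> real) \<Rightarrow> real" where
  "l2_inner \<Omega> u v = (\<integral>x. u x * v x \<partial>lebesgue_on \<Omega>)"

definition l2_norm :: "(real^2) set \<Rightarrow> (real^2 \<Rightarrow> real) \<Rightarrow> real" where
  "l2_norm \<Omega> u = sqrt (l2_inner \<Omega> u u)"

definition fin_dim_subspace_H1 :: "(real^2) set \<Rightarrow> (real^2 \<Rightarrow> real) set \<Rightarrow> bool" where
  "fin_dim_subspace_H1 \<Omega> V \<longleftrightarrow>
     V \<subseteq> H1 \<Omega> \<and> (\<lambda>x. 0) \<in> V \<and>
     (\<forall>u\<in>V. \<forall>v\<in>V. (\<lambda>x. u x + v x) \<in> V) \<and>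
     (\<forall>r. \<forall>u\<in>V. (\<lambda>x. r * u x) \<in> V) \<and>
     (\<exists>B. finite B \<and> B \<subseteq> V \<and> (\<forall>u\<in>V. \<exists>q. ae_eq \<Omega> u (\<lambda>x. \<Sum>b\<in>B. q b * b x)))"

definition robin_integrand ::
    "(real^2 \<Rightarrow> real) \<Rightarrow> (real^2 \<Rightarrow> real) \<Rightarrow> (real^2 \<Rightarrow> real) \<Rightarrow> (real^2 \<Rightarrow> real^2) \<Rightarrow>
     (real^2 \<Rightarrow> real) \<Rightarrow> (real^2 \<Rightarrow> real^2) \<Rightarrow> real^2 \<Rightarrow> real" where
  "robin_integrand \<kappa> c u G v H x = \<kappa> x * (G x \<bullet> H x) + c x * u x * v x"

definition robin_form ::
    "(real^2) list \<Rightarrow> (real^2 \<Rightarrow> real) \<Rightarrow> (real^2 \<Rightarrow> real) \<Rightarrow> (real^2 \<Rightarrow> real) \<Rightarrow>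
     (real^2 \<Rightarrow> real) \<Rightarrow> (real^2 \<Rightarrow> real) \<Rightarrow> real" where
  "robin_form vs \<kappa> c \<mu> u v =
     (\<integral>x. robin_integrand \<kappa> c u (weak_grad (polygon vs) u) v (weak_grad (polygon vs) v) x
        \<partial>lebesgue_on (polygon vs))
     + bd_integral vs (\<lambda>x. \<mu> x * bd_trace vs u x * bd_trace vs v x)"

text \<open>The form is well defined on \<open>V\<close>: traces exist, all integrals converge, and the value does
  not depend on the representatives chosen for gradients and traces (these are unique only almost
  everywhere, whereas \<open>weak_grad\<close> and \<open>bd_trace\<close> pick arbitrary ones).\<close>

definition robin_form_well_defined ::
    "(real^2) list \<Rightarrow> (real^2 \<Rightarrow> real) \<Rightarrow> (real^2 \<Rightarrow> real) \<Rightarrow> (real^2 \<Rightarrow> real) \<Rightarrow>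
     (real^2 \<Rightarrow> real) set \<Rightarrow> bool" where
  "robin_form_well_defined vs \<kappa> c \<mu> V \<longleftrightarrow>
     (\<forall>u\<in>V. \<exists>g. has_trace vs u g) \<and>
     (\<forall>u\<in>V. \<forall>v\<in>V. \<forall>G H g h.
        has_weak_grad (polygon vs) u G \<longrightarrow> has_weak_grad (polygon vs) v H \<longrightarrow>
        has_trace vs u g \<longrightarrow> has_trace vs v h \<longrightarrow>
          integrable (lebesgue_on (polygon vs)) (robin_integrand \<kappa> c u G v H) \<and>
          bd_integrable vs (\<lambda>x. \<mu> x * g x * h x) \<and>
          (\<integral>x. robin_integrand \<kappa> c u G v H x \<partial>lebesgue_on (polygon vs))
            + bd_integral vs (\<lambda>x. \<mu> x * g x * h x) = robin_form vs \<kappa> c \<mu> u v)"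

definition induced_operator ::
    "(real^2) set \<Rightarrow> (real^2 \<Rightarrow> real) set \<Rightarrow>
     ((real^2 \<Rightarrow> real) \<Rightarrow> (real^2 \<Rightarrow> real) \<Rightarrow> real) \<Rightarrow>
     ((real^2 \<Rightarrow> real) \<Rightarrow> (real^2 \<Rightarrow> real)) \<Rightarrow> bool" where
  "induced_operator \<Omega> V a A \<longleftrightarrow>
     (\<forall>y\<in>V. A y \<in> V \<and> (\<forall>v\<in>V. l2_inner \<Omega> (A y) v = a y v))"

text \<open>\<open>(w\<^sub>n)\<close>, \<open>n = -1, \<dots>, N\<close>, in \<open>V\<close> solves the backward Euler scheme with time-independent
  right-hand side \<open>f\<close> and the condition \<open>w\<^sub>0 = \<phi>\<close>.\<close>

definition solves_scheme ::
    "(real^2) set \<Rightarrow> (real^2 \<Rightarrow> real) set \<Rightarrow> ((real^2 \<Rightarrow> real) \<Rightarrow> (real^2 \<Rightarrow> real)) \<Rightarrow> real \<Rightarrow> nat \<Rightarrow>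
     (real^2 \<Rightarrow> real) \<Rightarrow> (real^2 \<Rightarrow> real) \<Rightarrow> (int \<Rightarrow> real^2 \<Rightarrow> real) \<Rightarrow> bool" where
  "solves_scheme \<Omega> V A \<tau> N \<phi> f w \<longleftrightarrow>
     (\<forall>n\<in>{-1..int N}. w n \<in> V) \<and>
     (\<forall>n\<in>{-1..int N - 1}. ae_eq \<Omega> (\<lambda>x. (w (n + 1) x - w n x) / \<tau> + A (w (n + 1)) x) f) \<and>
     ae_eq \<Omega> (w 0) \<phi>"

end

(* Let g_k = fk k - f, z_n = wk k n - w n and d_n = (z_n - z_(n-1)) / tau. Subtracting consecutive
   equations of the scheme for z gives (I + tau A) d_(n+1) = d_n for 0 <= n < N; the equation at
   n = -1 with z_0 = 0 gives d_0 = g_k, and the update rule gives g_(k+1) = d_N. Coercivity yields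
   (1 + tau delta) |d_(n+1)| <= |d_n|, hence the rate (1 + tau delta)^(-N). All these identities are
   tested against elements of V, so that only linearity of a in its first argument and its
   invariance under change of representative enter, never linearity of A. *)

theory Submission
  imports Defs
begin

section \<open>Square-integrable functions\<close>

lemma sq_integrable_lincomb:
  assumes "sq_integrable M f" "sq_integrable M g"
  shows "sq_integrable M (\<lambda>x. r *\<^sub>R f x + s *\<^sub>R g x)"
    and "(\<integral>x. (norm (r *\<^sub>R f x + s *\<^sub>R g x))\<^sup>2 \<partial>M)
           \<le> 2 * r\<^sup>2 * (\<integral>x. (norm (f x))\<^sup>2 \<partial>M) + 2 * s\<^sup>2 * (\<integral>x. (norm (g x))\<^sup>2 \<partial>M)"
proof -
  have [measurable]: "f \<in> borel_measurable M" "g \<in> borel_measurable M"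
    and i: "integrable M (\<lambda>x. (norm (f x))\<^sup>2)" "integrable M (\<lambda>x. (norm (g x))\<^sup>2)"
    using assms by (auto simp: sq_integrable_def)
  \<comment> \<open>The factor 2 comes from absorbing the mixed term by
    \<open>2 * x * y \<le> x^2 + y^2\<close>, so that the right side contains no product of
    \<open>f\<close> and \<open>g\<close>.\<close>
  have le: "(norm (r *\<^sub>R f x + s *\<^sub>R g x))\<^sup>2 \<le> 2 * r\<^sup>2 * (norm (f x))\<^sup>2 + 2 * s\<^sup>2 * (norm (g x))\<^sup>2" for x
  proof -
    have "(norm (r *\<^sub>R f x + s *\<^sub>R g x))\<^sup>2 \<le> (\<bar>r\<bar> * norm (f x) + \<bar>s\<bar> * norm (g x))\<^sup>2"
      by (intro power_mono norm_triangle_le) auto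
    also have "\<dots> \<le> 2 * (\<bar>r\<bar> * norm (f x))\<^sup>2 + 2 * (\<bar>s\<bar> * norm (g x))\<^sup>2"
      using sum_squares_bound[of "\<bar>r\<bar> * norm (f x)" "\<bar>s\<bar> * norm (g x)"]
      by (simp add: power2_sum)
    finally show ?thesis by (simp add: power_mult_distrib)
  qed
  have ii: "integrable M (\<lambda>x. 2 * r\<^sup>2 * (norm (f x))\<^sup>2 + 2 * s\<^sup>2 * (norm (g x))\<^sup>2)"
    using i by auto
  have i3: "integrable M (\<lambda>x. (norm (r *\<^sub>R f x + s *\<^sub>R g x))\<^sup>2)"
    by (rule Bochner_Integration.integrable_bound[OF ii]) (use le in \<open>auto intro!: AE_I2\<close>)
  then show "sq_integrable M (\<lambda>x. r *\<^sub>R f x + s *\<^sub>R g x)"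
    by (simp add: sq_integrable_def)
  \<comment> \<open>The integrated form is the quantitative half: it makes the errors of two
    approximating sequences control the error of their combination in
    \<open>has_trace_lincomb\<close>.\<close>
  have "(\<integral>x. (norm (r *\<^sub>R f x + s *\<^sub>R g x))\<^sup>2 \<partial>M)
      \<le> (\<integral>x. 2 * r\<^sup>2 * (norm (f x))\<^sup>2 + 2 * s\<^sup>2 * (norm (g x))\<^sup>2 \<partial>M)"
    by (intro integral_mono i3 ii le)
  also have "\<dots> = 2 * r\<^sup>2 * (\<integral>x. (norm (f x))\<^sup>2 \<partial>M) + 2 * s\<^sup>2 * (\<integral>x. (norm (g x))\<^sup>2 \<partial>M)"
    using i by simp
  finally show "(\<integral>x. (norm (r *\<^sub>R f x + s *\<^sub>R g x))\<^sup>2 \<partial>M)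
           \<le> 2 * r\<^sup>2 * (\<integral>x. (norm (f x))\<^sup>2 \<partial>M) + 2 * s\<^sup>2 * (\<integral>x. (norm (g x))\<^sup>2 \<partial>M)" .
qed

lemma sq_integrable_lincomb_real:
  fixes f g :: "'a \<Rightarrow> real"
  assumes "sq_integrable M f" "sq_integrable M g"
  shows "sq_integrable M (\<lambda>x. r * f x + s * g x)"
    and "(\<integral>x. (r * f x + s * g x)\<^sup>2 \<partial>M)
           \<le> 2 * r\<^sup>2 * (\<integral>x. (f x)\<^sup>2 \<partial>M) + 2 * s\<^sup>2 * (\<integral>x. (g x)\<^sup>2 \<partial>M)"
  using sq_integrable_lincomb[OF assms, of r s] by auto

lemma sq_integrable_diff:
  assumes "sq_integrable M f" "sq_integrable M g"
  shows "sq_integrable M (\<lambda>x. f x - g x)"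
  using sq_integrable_lincomb(1)[OF assms, of 1 "-1"] by simp

text \<open>The bound \<open>\<bar>f x * g x\<bar> \<le> (f x)\<^sup>2 + (g x)\<^sup>2\<close>
  supplies an integrable majorant. This is the source of integrability whenever a scalar product or
  a tested weak identity is split.\<close>

lemma sq_integrable_mult:
  fixes f g :: "'a \<Rightarrow> real"
  assumes "sq_integrable M f" "sq_integrable M g"
  shows "integrable M (\<lambda>x. f x * g x)"
proof -
  have [measurable]: "f \<in> borel_measurable M" "g \<in> borel_measurable M"
    and i: "integrable M (\<lambda>x. (f x)\<^sup>2)" "integrable M (\<lambda>x. (g x)\<^sup>2)"
    using assms by (auto simp: sq_integrable_def)
  have le: "\<bar>f x * g x\<bar> \<le> (f x)\<^sup>2 + (g x)\<^sup>2" for x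
    using sum_squares_bound[of "\<bar>f x\<bar>" "\<bar>g x\<bar>"]
      mult_nonneg_nonneg[of "\<bar>f x\<bar>" "\<bar>g x\<bar>"]
    by (simp add: abs_mult del: mult_nonneg_nonneg)
  show ?thesis
    by (rule Bochner_Integration.integrable_bound[OF Bochner_Integration.integrable_add[OF i]])
       (use le in \<open>auto intro!: AE_I2\<close>)
qed

text \<open>Cauchy-Schwarz bounds the component by the norm. It is applied to weak gradients with
  \<open>b\<close> a basis vector.\<close>

lemma sq_integrable_inner_const:
  assumes "sq_integrable M f" "norm b \<le> 1"
  shows "sq_integrable M (\<lambda>x. f x \<bullet> b)"
proof -
  have [measurable]: "f \<in> borel_measurable M" and i: "integrable M (\<lambda>x. (norm (f x))\<^sup>2)"
    using assms by (auto simp: sq_integrable_def)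
  have le: "(f x \<bullet> b)\<^sup>2 \<le> (norm (f x))\<^sup>2" for x
  proof -
    have "\<bar>f x \<bullet> b\<bar> \<le> norm (f x) * norm b" by (rule Cauchy_Schwarz_ineq2)
    also have "\<dots> \<le> norm (f x)" using assms(2) by (simp add: mult_left_le)
    finally have "\<bar>f x \<bullet> b\<bar>\<^sup>2 \<le> (norm (f x))\<^sup>2" by (intro power_mono) auto
    then show ?thesis by simp
  qed
  have "integrable M (\<lambda>x. (f x \<bullet> b)\<^sup>2)"
    by (rule Bochner_Integration.integrable_bound[OF i]) (use le in \<open>auto intro!: AE_I2\<close>)
  then show ?thesis by (simp add: sq_integrable_def)
qed

text \<open>Compactness of the closure makes \<open>f\<close> bounded on \<open>S\<close>, and a
  bounded measurable set has finite measure. Test functions, smooth approximants and their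
  restrictions to edges are all handled this way.\<close>

lemma sq_integrable_continuous:
  fixes f :: "'a::euclidean_space \<Rightarrow> 'b::euclidean_space"
  assumes "continuous_on UNIV f" "bounded S" "S \<in> sets lebesgue"
  shows "sq_integrable (lebesgue_on S) f"
proof -
  have [measurable]: "f \<in> borel_measurable (lebesgue_on S)"
    using assms by (intro continuous_imp_measurable_on_sets_lebesgue) (auto intro: continuous_on_subset)
  have "compact (f ` closure S)"
    using assms by (intro compact_continuous_image) (auto intro: continuous_on_subset)
  then obtain B where B: "\<And>x. x \<in> closure S \<Longrightarrow> norm (f x) \<le> B"
    by (meson bounded_iff compact_imp_bounded image_eqI)
  have fin: "finite_measure (lebesgue_on S)"
    using assms bounded_set_imp_lmeasurable finite_measure_lebesgue_on by blast
  have "integrable (lebesgue_on S) (\<lambda>x. (norm (f x))\<^sup>2)"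
  proof (rule finite_measure.integrable_const_bound[OF fin, of _ "B\<^sup>2"])
    show "AE x in lebesgue_on S. norm ((norm (f x))\<^sup>2) \<le> B\<^sup>2"
      using B closure_subset[of S] by (intro AE_I2) (auto simp: space_restrict_space intro!: power_mono)
  qed auto
  then show ?thesis by (simp add: sq_integrable_def)
qed

section \<open>Smooth functions and classical gradients\<close>

lemma partial_deriv_lincomb:
  assumes "f differentiable (at x)" "g differentiable (at x)"
  shows "partial_deriv b (\<lambda>x. r * f x + s * g x) x = r * partial_deriv b f x + s * partial_deriv b g x"
proof -
  have "((\<lambda>x. r * f x + s * g x) has_derivative
      (\<lambda>h. r * frechet_derivative f (at x) h + s * frechet_derivative g (at x) h)) (at x)"
    using assms by (auto intro!: derivative_eq_intros simp: frechet_derivative_works)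
  from frechet_derivative_at[OF this] show ?thesis
    by (simp add: partial_deriv_def) (metis (no_types))
qed

lemma Ck_lincomb: "Ck n f \<Longrightarrow> Ck n g \<Longrightarrow> Ck n (\<lambda>x. r * f x + s * g x)"
proof (induction n arbitrary: f g)
  case 0
  then show ?case by (auto intro!: continuous_intros)
next
  case (Suc n)
  \<comment> \<open>Differentiability everywhere upgrades the pointwise rule to an equation of
    functions; the induction hypothesis can then be applied to the partial derivatives in place of
    \<open>f\<close> and \<open>g\<close>.\<close>
  then have "partial_deriv b (\<lambda>x. r * f x + s * g x) =
      (\<lambda>x. r * partial_deriv b f x + s * partial_deriv b g x)" for b
    by (auto simp: partial_deriv_lincomb)
  with Suc show ?case by auto
qed

lemma smooth_lincomb: "smooth f \<Longrightarrow> smooth g \<Longrightarrow> smooth (\<lambda>x. r * f x + s * g x)"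
  by (simp add: smooth_def Ck_lincomb)

lemma smooth_differentiable: "smooth f \<Longrightarrow> f differentiable (at x)"
  unfolding smooth_def by (metis Ck.simps(2))

lemma smooth_continuous: "smooth f \<Longrightarrow> continuous_on UNIV f"
  unfolding smooth_def by (metis Ck.simps(1))

lemma smooth_continuous_partial_deriv:
  "smooth f \<Longrightarrow> b \<in> Basis \<Longrightarrow> continuous_on UNIV (partial_deriv b f)"
  unfolding smooth_def by (metis Ck.simps)

lemma smooth_continuous_grad: "smooth f \<Longrightarrow> continuous_on UNIV (grad f)"
  unfolding grad_def[abs_def] by (intro continuous_intros smooth_continuous_partial_deriv)

lemma grad_lincomb:
  assumes "smooth f" "smooth g"
  shows "grad (\<lambda>x. r * f x + s * g x) x = r *\<^sub>R grad f x + s *\<^sub>R grad g x"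
  using assms
  by (simp add: grad_def partial_deriv_lincomb smooth_differentiable scaleR_add_left
      sum.distrib scaleR_sum_right)

section \<open>Weak gradients of linear combinations\<close>

lemma has_weak_grad_lincomb:
  assumes u: "has_weak_grad \<Omega> u G" and v: "has_weak_grad \<Omega> v H"
    and \<Omega>: "bounded \<Omega>" "\<Omega> \<in> sets lebesgue"
  shows "has_weak_grad \<Omega> (\<lambda>x. r * u x + s * v x) (\<lambda>x. r *\<^sub>R G x + s *\<^sub>R H x)"
  unfolding has_weak_grad_def
proof (intro conjI allI impI ballI)
  have sq: "sq_integrable (lebesgue_on \<Omega>) u" "sq_integrable (lebesgue_on \<Omega>) G"
    "sq_integrable (lebesgue_on \<Omega>) v" "sq_integrable (lebesgue_on \<Omega>) H"
    using u v by (auto simp: has_weak_grad_def)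
  show "sq_integrable (lebesgue_on \<Omega>) (\<lambda>x. r * u x + s * v x)"
    using sq by (intro sq_integrable_lincomb_real)
  show "sq_integrable (lebesgue_on \<Omega>) (\<lambda>x. r *\<^sub>R G x + s *\<^sub>R H x)"
    using sq by (intro sq_integrable_lincomb)
  fix p and b :: "real^2" assume p: "test_function \<Omega> p" and b: "b \<in> Basis"
  then have sm: "smooth p" by (simp add: test_function_def)
  have sp: "sq_integrable (lebesgue_on \<Omega>) p" "sq_integrable (lebesgue_on \<Omega>) (partial_deriv b p)"
    by (intro sq_integrable_continuous smooth_continuous[OF sm]
        smooth_continuous_partial_deriv[OF sm b] \<Omega>)+
  have sb: "sq_integrable (lebesgue_on \<Omega>) (\<lambda>x. G x \<bullet> b)" "sq_integrable (lebesgue_on \<Omega>) (\<lambda>x. H x \<bullet> b)"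
    using sq b by (auto intro!: sq_integrable_inner_const)
  \<comment> \<open>All four products must be integrable before the integrals can be split, since a
    non-integrable function has integral 0 by convention.\<close>
  note i = sq_integrable_mult[OF sq(1) sp(2)] sq_integrable_mult[OF sq(3) sp(2)]
    sq_integrable_mult[OF sb(1) sp(1)] sq_integrable_mult[OF sb(2) sp(1)]
  have "(\<integral>x. (r * u x + s * v x) * partial_deriv b p x \<partial>lebesgue_on \<Omega>)
      = r * (\<integral>x. u x * partial_deriv b p x \<partial>lebesgue_on \<Omega>)
        + s * (\<integral>x. v x * partial_deriv b p x \<partial>lebesgue_on \<Omega>)"
    using i by (simp add: distrib_right mult.assoc)
  also have "\<dots> = r * (- (\<integral>x. (G x \<bullet> b) * p x \<partial>lebesgue_on \<Omega>))
        + s * (- (\<integral>x. (H x \<bullet> b) * p x \<partial>lebesgue_on \<Omega>))"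
    using u v p b by (simp add: has_weak_grad_def)
  also have "\<dots> = - (\<integral>x. ((r *\<^sub>R G x + s *\<^sub>R H x) \<bullet> b) * p x \<partial>lebesgue_on \<Omega>)"
    using i by (simp add: distrib_right mult.assoc inner_add_left)
  finally show "(\<integral>x. (r * u x + s * v x) * partial_deriv b p x \<partial>lebesgue_on \<Omega>)
      = - (\<integral>x. ((r *\<^sub>R G x + s *\<^sub>R H x) \<bullet> b) * p x \<partial>lebesgue_on \<Omega>)" .
qed

section \<open>Integrals over the boundary\<close>

lemma bd_sq_integrable_lincomb:
  assumes "bd_sq_integrable vs g" "bd_sq_integrable vs h"
  shows "bd_sq_integrable vs (\<lambda>x. r * g x + s * h x)"
    and "bd_integral vs (\<lambda>x. (r * g x + s * h x)\<^sup>2)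
           \<le> 2 * r\<^sup>2 * bd_integral vs (\<lambda>x. (g x)\<^sup>2) + 2 * s\<^sup>2 * bd_integral vs (\<lambda>x. (h x)\<^sup>2)"
proof -
  have sq: "sq_integrable (lebesgue_on {0..1}) (\<lambda>t. g (edge vs i t))"
    "sq_integrable (lebesgue_on {0..1}) (\<lambda>t. h (edge vs i t))" if "i < length vs" for i
    using assms that by (auto simp: bd_sq_integrable_def)
  show "bd_sq_integrable vs (\<lambda>x. r * g x + s * h x)"
    unfolding bd_sq_integrable_def using sq by (auto intro: sq_integrable_lincomb_real)
  \<comment> \<open>The bound holds on each parametrised edge, and the edge lengths are nonnegative
    weights, so it survives summation.\<close>
  have "bd_integral vs (\<lambda>x. (r * g x + s * h x)\<^sup>2) \<le>
    (\<Sum>i<length vs. edge_length vs i *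
       (2 * r\<^sup>2 * (\<integral>t. (g (edge vs i t))\<^sup>2 \<partial>lebesgue_on {0..1})
        + 2 * s\<^sup>2 * (\<integral>t. (h (edge vs i t))\<^sup>2 \<partial>lebesgue_on {0..1})))"
    unfolding bd_integral_def using sq
    by (intro sum_mono mult_left_mono sq_integrable_lincomb_real) (auto simp: edge_length_def)
  also have "\<dots> = 2 * r\<^sup>2 * bd_integral vs (\<lambda>x. (g x)\<^sup>2) + 2 * s\<^sup>2 * bd_integral vs (\<lambda>x. (h x)\<^sup>2)"
    by (simp add: bd_integral_def sum_distrib_left sum.distrib algebra_simps)
  finally show "bd_integral vs (\<lambda>x. (r * g x + s * h x)\<^sup>2)
           \<le> 2 * r\<^sup>2 * bd_integral vs (\<lambda>x. (g x)\<^sup>2) + 2 * s\<^sup>2 * bd_integral vs (\<lambda>x. (h x)\<^sup>2)" .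
qed

lemma bd_integral_lincomb:
  assumes "bd_integrable vs g" "bd_integrable vs h"
  shows "bd_integral vs (\<lambda>x. r * g x + s * h x) = r * bd_integral vs g + s * bd_integral vs h"
proof -
  have "(\<integral>t. r * g (edge vs i t) + s * h (edge vs i t) \<partial>lebesgue_on {0..1})
      = r * (\<integral>t. g (edge vs i t) \<partial>lebesgue_on {0..1})
        + s * (\<integral>t. h (edge vs i t) \<partial>lebesgue_on {0..1})" if "i < length vs" for i
    using assms that by (simp add: bd_integrable_def)
  then show ?thesis
    by (simp add: bd_integral_def sum_distrib_left sum.distrib[symmetric] algebra_simps)
qed

lemma bd_integral_nonneg: "(\<And>x. 0 \<le> g x) \<Longrightarrow> 0 \<le> bd_integral vs g"
  unfolding bd_integral_def by (auto intro!: sum_nonneg mult_nonneg_nonneg simp: edge_length_def)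

lemma bd_sq_integrable_continuous:
  assumes "continuous_on UNIV g"
  shows "bd_sq_integrable vs g"
proof -
  have "continuous_on UNIV (\<lambda>t. g (edge vs i t))" for i
    unfolding edge_def
    by (rule continuous_on_compose2[OF assms]) (auto intro: continuous_on_linepath)
  then show ?thesis
    unfolding bd_sq_integrable_def by (auto intro!: sq_integrable_continuous)
qed

section \<open>Traces of linear combinations\<close>

lemma tendsto_0_lincomb_bound:
  fixes X Y Z :: "nat \<Rightarrow> real"
  assumes "X \<longlonglongrightarrow> 0" "Y \<longlonglongrightarrow> 0" "\<And>j. 0 \<le> Z j" "\<And>j. Z j \<le> a * X j + b * Y j"
  shows "Z \<longlonglongrightarrow> 0"
proof (rule tendsto_sandwich[OF _ _ tendsto_const])
  show "(\<lambda>j. a * X j + b * Y j) \<longlonglongrightarrow> 0"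
    using assms(1,2) by (auto intro!: tendsto_eq_intros)
qed (use assms(3,4) in auto)

text \<open>The boundary is the image of a path, hence compact: its inside is bounded because it is
  bounded, and open because it is closed.\<close>

lemma polygon_bounded_measurable:
  assumes "simple_polygon vs"
  shows "bounded (polygon vs)" "polygon vs \<in> sets lebesgue"
proof -
  have c: "compact (path_image (polygon_boundary vs))"
    using assms by (simp add: simple_polygon_def simple_path_imp_path compact_path_image)
  show "bounded (polygon vs)"
    unfolding polygon_def using c by (simp add: bounded_inside compact_imp_bounded)
  have "open (polygon vs)"
    unfolding polygon_def using c by (simp add: open_inside compact_imp_closed)
  then show "polygon vs \<in> sets lebesgue" by simp
qed

text \<open>The same combination of the two approximating sequences works: in the domain, for the
  gradients and on the boundary, its squared error is dominated by \<open>2 * r\<^sup>2\<close> and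
  \<open>2 * s\<^sup>2\<close> times the separate errors, which tend to 0.\<close>

lemma has_trace_lincomb:
  assumes vs: "simple_polygon vs" and u: "has_trace vs u g" and v: "has_trace vs v h"
  shows "has_trace vs (\<lambda>x. r * u x + s * v x) (\<lambda>x. r * g x + s * h x)"
proof -
  let ?M = "lebesgue_on (polygon vs)"
  note P = polygon_bounded_measurable[OF vs]
  obtain G p where G: "bd_sq_integrable vs g" "has_weak_grad (polygon vs) u G" "\<And>j::nat. smooth (p j)"
    "(\<lambda>j. \<integral>x. (p j x - u x)\<^sup>2 \<partial>?M) \<longlonglongrightarrow> 0"
    "(\<lambda>j. \<integral>x. (norm (grad (p j) x - G x))\<^sup>2 \<partial>?M) \<longlonglongrightarrow> 0"
    "(\<lambda>j. bd_integral vs (\<lambda>x. (p j x - g x)\<^sup>2)) \<longlonglongrightarrow> 0"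
    using u unfolding has_trace_def by blast
  obtain H q where H: "bd_sq_integrable vs h" "has_weak_grad (polygon vs) v H" "\<And>j::nat. smooth (q j)"
    "(\<lambda>j. \<integral>x. (q j x - v x)\<^sup>2 \<partial>?M) \<longlonglongrightarrow> 0"
    "(\<lambda>j. \<integral>x. (norm (grad (q j) x - H x))\<^sup>2 \<partial>?M) \<longlonglongrightarrow> 0"
    "(\<lambda>j. bd_integral vs (\<lambda>x. (q j x - h x)\<^sup>2)) \<longlonglongrightarrow> 0"
    using v unfolding has_trace_def by blast
  have sq: "sq_integrable ?M u" "sq_integrable ?M G" "sq_integrable ?M v" "sq_integrable ?M H"
    using G(2) H(2) by (auto simp: has_weak_grad_def)
  have d: "sq_integrable ?M (\<lambda>x. p j x - u x)" "sq_integrable ?M (\<lambda>x. q j x - v x)"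
    "sq_integrable ?M (\<lambda>x. grad (p j) x - G x)" "sq_integrable ?M (\<lambda>x. grad (q j) x - H x)" for j
    using sq P G(3) H(3)
    by (auto intro!: sq_integrable_diff sq_integrable_continuous smooth_continuous smooth_continuous_grad)
  have bd: "bd_sq_integrable vs (\<lambda>x. p j x - g x)" "bd_sq_integrable vs (\<lambda>x. q j x - h x)" for j
    using bd_sq_integrable_lincomb(1)[OF bd_sq_integrable_continuous[OF smooth_continuous[OF G(3)[of j]]] G(1), of 1 "-1"]
      bd_sq_integrable_lincomb(1)[OF bd_sq_integrable_continuous[OF smooth_continuous[OF H(3)[of j]]] H(1), of 1 "-1"]
    by auto
  \<comment> \<open>With \<open>a\<close> and \<open>b\<close> left free, one identity serves both
    the domain error (values of \<open>u\<close>, \<open>v\<close>) and the boundary error (values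
    of \<open>g\<close>, \<open>h\<close>).\<close>
  have eq: "r * p j x + s * q j x - (r * a + s * b) = r * (p j x - a) + s * (q j x - b)" for j x a b
    by (simp add: algebra_simps)
  have eqg: "grad (\<lambda>x. r * p j x + s * q j x) x - (r *\<^sub>R G x + s *\<^sub>R H x) =
      r *\<^sub>R (grad (p j) x - G x) + s *\<^sub>R (grad (q j) x - H x)" for j x
    by (simp add: grad_lincomb G(3) H(3) algebra_simps)
  show ?thesis
    unfolding has_trace_def
  proof (intro conjI exI allI)
    show "bd_sq_integrable vs (\<lambda>x. r * g x + s * h x)"
      using G(1) H(1) by (rule bd_sq_integrable_lincomb)
    show "has_weak_grad (polygon vs) (\<lambda>x. r * u x + s * v x) (\<lambda>x. r *\<^sub>R G x + s *\<^sub>R H x)"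
      using G(2) H(2) P by (rule has_weak_grad_lincomb)
    show "smooth (\<lambda>x. r * p j x + s * q j x)" for j
      using G(3) H(3) by (rule smooth_lincomb)
    show "(\<lambda>j. \<integral>x. (r * p j x + s * q j x - (r * u x + s * v x))\<^sup>2 \<partial>?M) \<longlonglongrightarrow> 0"
      unfolding eq
      by (rule tendsto_0_lincomb_bound[OF G(4) H(4) _ sq_integrable_lincomb_real(2)[OF d(1,2)]]) auto
    show "(\<lambda>j. \<integral>x. (norm (grad (\<lambda>x. r * p j x + s * q j x) x - (r *\<^sub>R G x + s *\<^sub>R H x)))\<^sup>2 \<partial>?M)
        \<longlonglongrightarrow> 0"
      unfolding eqg
      by (rule tendsto_0_lincomb_bound[OF G(5) H(5) _ sq_integrable_lincomb(2)[OF d(3,4)]]) auto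
    show "(\<lambda>j. bd_integral vs (\<lambda>x. (r * p j x + s * q j x - (r * g x + s * h x))\<^sup>2)) \<longlonglongrightarrow> 0"
      unfolding eq
      by (rule tendsto_0_lincomb_bound[OF G(6) H(6) _ bd_sq_integrable_lincomb(2)[OF bd]])
         (auto intro: bd_integral_nonneg)
  qed
qed

section \<open>Change of representative\<close>

lemma H1_sq_integrable: "u \<in> H1 \<Omega> \<Longrightarrow> sq_integrable (lebesgue_on \<Omega>) u"
  by (auto simp: H1_def has_weak_grad_def)

text \<open>The function enters the weak identity only under an integral, which ignores null sets,
  so the gradient \<open>G\<close> can be kept.\<close>

lemma has_weak_grad_ae_cong:
  assumes "has_weak_grad \<Omega> u G" "ae_eq \<Omega> u v" "sq_integrable (lebesgue_on \<Omega>) v"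
    and \<Omega>: "bounded \<Omega>" "\<Omega> \<in> sets lebesgue"
  shows "has_weak_grad \<Omega> v G"
proof -
  have "(\<integral>x. v x * partial_deriv b p x \<partial>lebesgue_on \<Omega>) = (\<integral>x. u x * partial_deriv b p x \<partial>lebesgue_on \<Omega>)"
    if p: "test_function \<Omega> p" and b: "b \<in> Basis" for p b
  proof (rule integral_cong_AE)
    have "sq_integrable (lebesgue_on \<Omega>) (partial_deriv b p)"
      using p b \<Omega>
      by (auto intro!: sq_integrable_continuous smooth_continuous_partial_deriv simp: test_function_def)
    then have [measurable]: "partial_deriv b p \<in> borel_measurable (lebesgue_on \<Omega>)"
      "u \<in> borel_measurable (lebesgue_on \<Omega>)" "v \<in> borel_measurable (lebesgue_on \<Omega>)"
      using assms by (auto simp: has_weak_grad_def sq_integrable_def)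
    show "(\<lambda>x. v x * partial_deriv b p x) \<in> borel_measurable (lebesgue_on \<Omega>)"
      "(\<lambda>x. u x * partial_deriv b p x) \<in> borel_measurable (lebesgue_on \<Omega>)" by measurable
    show "AE x in lebesgue_on \<Omega>. v x * partial_deriv b p x = u x * partial_deriv b p x"
      using assms(2) unfolding ae_eq_def by eventually_elim simp
  qed
  then show ?thesis
    using assms by (auto simp: has_weak_grad_def)
qed

text \<open>The smooth sequence and the weak gradient belonging to \<open>u\<close> also serve
  \<open>v\<close>: the gradient and boundary errors do not mention the function, and the domain
  error is unchanged by a modification on a null set.\<close>

lemma has_trace_ae_cong:
  assumes vs: "simple_polygon vs" and u: "has_trace vs u g"
    and ae: "ae_eq (polygon vs) u v" and v: "sq_integrable (lebesgue_on (polygon vs)) v"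
  shows "has_trace vs v g"
proof -
  let ?M = "lebesgue_on (polygon vs)"
  note P = polygon_bounded_measurable[OF vs]
  obtain G p where G: "bd_sq_integrable vs g" "has_weak_grad (polygon vs) u G" "\<And>j::nat. smooth (p j)"
    "(\<lambda>j. \<integral>x. (p j x - u x)\<^sup>2 \<partial>?M) \<longlonglongrightarrow> 0"
    "(\<lambda>j. \<integral>x. (norm (grad (p j) x - G x))\<^sup>2 \<partial>?M) \<longlonglongrightarrow> 0"
    "(\<lambda>j. bd_integral vs (\<lambda>x. (p j x - g x)\<^sup>2)) \<longlonglongrightarrow> 0"
    using u unfolding has_trace_def by blast
  have eq: "(\<integral>x. (p j x - v x)\<^sup>2 \<partial>?M) = (\<integral>x. (p j x - u x)\<^sup>2 \<partial>?M)" for j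
  proof (rule integral_cong_AE)
    have "sq_integrable ?M (p j)"
      using G(3) P by (auto intro!: sq_integrable_continuous smooth_continuous)
    then have [measurable]: "p j \<in> borel_measurable ?M" "u \<in> borel_measurable ?M" "v \<in> borel_measurable ?M"
      using v G(2) by (auto simp: has_weak_grad_def sq_integrable_def)
    show "(\<lambda>x. (p j x - v x)\<^sup>2) \<in> borel_measurable ?M" "(\<lambda>x. (p j x - u x)\<^sup>2) \<in> borel_measurable ?M"
      by measurable
    show "AE x in ?M. (p j x - v x)\<^sup>2 = (p j x - u x)\<^sup>2"
      using ae unfolding ae_eq_def by eventually_elim simp
  qed
  show ?thesis
    unfolding has_trace_def
  proof (intro conjI exI allI)
    show "has_weak_grad (polygon vs) v G"
      using G(2) ae v P by (rule has_weak_grad_ae_cong)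
    show "(\<lambda>j. \<integral>x. (p j x - v x)\<^sup>2 \<partial>?M) \<longlonglongrightarrow> 0"
      unfolding eq by (rule G(4))
  qed (rule G)+
qed

section \<open>Linearity and invariance of the Robin form\<close>

lemma fin_dim_subspace_H1_lincomb:
  assumes "fin_dim_subspace_H1 \<Omega> V" "u \<in> V" "v \<in> V"
  shows "(\<lambda>x. r * u x + s * v x) \<in> V"
proof -
  have add: "\<forall>u\<in>V. \<forall>v\<in>V. (\<lambda>x. u x + v x) \<in> V"
    and scale: "\<forall>r. \<forall>u\<in>V. (\<lambda>x. r * u x) \<in> V"
    using assms(1) unfolding fin_dim_subspace_H1_def by - (elim conjE, assumption)+
  show ?thesis
    by (rule add[THEN bspec, THEN bspec, OF scale[THEN spec, THEN bspec] scale[THEN spec, THEN bspec]])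
       (fact assms)+
qed

text \<open>The representatives picked by \<open>weak_grad\<close> and \<open>bd_trace\<close> need
  not depend linearly on the function. Well-definedness lets the form be evaluated with any
  representatives, in particular with linear combinations of those for \<open>u\<close> and
  \<open>v\<close>.\<close>

lemma robin_form_lincomb:
  assumes vs: "simple_polygon vs" and V: "fin_dim_subspace_H1 (polygon vs) V"
    and wd: "robin_form_well_defined vs \<kappa> c \<mu> V"
    and "u \<in> V" "v \<in> V" "y \<in> V"
  shows "robin_form vs \<kappa> c \<mu> (\<lambda>x. r * u x + s * v x) y
       = r * robin_form vs \<kappa> c \<mu> u y + s * robin_form vs \<kappa> c \<mu> v y"
proof -
  let ?P = "polygon vs" and ?M = "lebesgue_on (polygon vs)"
  note P = polygon_bounded_measurable[OF vs]
  have z: "(\<lambda>x. r * u x + s * v x) \<in> V"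
    using V assms(4,5) by (rule fin_dim_subspace_H1_lincomb)
  have "V \<subseteq> H1 ?P" using V by (simp add: fin_dim_subspace_H1_def)
  then obtain Gu Gv Gy where G: "has_weak_grad ?P u Gu" "has_weak_grad ?P v Gv" "has_weak_grad ?P y Gy"
    using assms(4-6) unfolding H1_def by blast
  obtain gu gv gy where g: "has_trace vs u gu" "has_trace vs v gv" "has_trace vs y gy"
    using wd[unfolded robin_form_well_defined_def, THEN conjunct1] assms(4-6) by blast
  \<comment> \<open>The data of the second argument are fixed once as \<open>Gy\<close> and
    \<open>gy\<close>, so the three evaluations below share them.\<close>
  have rf: "integrable ?M (robin_integrand \<kappa> c p G y Gy) \<and>
      bd_integrable vs (\<lambda>x. \<mu> x * g x * gy x) \<and>
      (\<integral>x. robin_integrand \<kappa> c p G y Gy x \<partial>?M) + bd_integral vs (\<lambda>x. \<mu> x * g x * gy x)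
        = robin_form vs \<kappa> c \<mu> p y"
    if "p \<in> V" "has_weak_grad ?P p G" "has_trace vs p g" for p G g
    using wd that \<open>y \<in> V\<close> G(3) g(3) unfolding robin_form_well_defined_def by blast
  note U = rf[OF \<open>u \<in> V\<close> G(1) g(1)] and W = rf[OF \<open>v \<in> V\<close> G(2) g(2)]
  have "robin_form vs \<kappa> c \<mu> (\<lambda>x. r * u x + s * v x) y =
     (\<integral>x. robin_integrand \<kappa> c (\<lambda>x. r * u x + s * v x) (\<lambda>x. r *\<^sub>R Gu x + s *\<^sub>R Gv x) y Gy x \<partial>?M)
      + bd_integral vs (\<lambda>x. \<mu> x * (r * gu x + s * gv x) * gy x)"
    using rf[OF z has_weak_grad_lincomb[OF G(1,2) P] has_trace_lincomb[OF vs g(1,2)]] by simp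
  also have "(\<lambda>x. robin_integrand \<kappa> c (\<lambda>x. r * u x + s * v x) (\<lambda>x. r *\<^sub>R Gu x + s *\<^sub>R Gv x) y Gy x)
      = (\<lambda>x. r * robin_integrand \<kappa> c u Gu y Gy x + s * robin_integrand \<kappa> c v Gv y Gy x)"
    by (auto simp: robin_integrand_def inner_add_left algebra_simps)
  also have "(\<lambda>x. \<mu> x * (r * gu x + s * gv x) * gy x)
      = (\<lambda>x. r * (\<mu> x * gu x * gy x) + s * (\<mu> x * gv x * gy x))"
    by (auto simp: algebra_simps)
  finally have "robin_form vs \<kappa> c \<mu> (\<lambda>x. r * u x + s * v x) y =
      r * ((\<integral>x. robin_integrand \<kappa> c u Gu y Gy x \<partial>?M) + bd_integral vs (\<lambda>x. \<mu> x * gu x * gy x))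
      + s * ((\<integral>x. robin_integrand \<kappa> c v Gv y Gy x \<partial>?M) + bd_integral vs (\<lambda>x. \<mu> x * gv x * gy x))"
    \<comment> \<open>These conjuncts are the integrability statements that allow the domain and
      boundary integrals to be split.\<close>
    using U[THEN conjunct1] W[THEN conjunct1]
      U[THEN conjunct2, THEN conjunct1] W[THEN conjunct2, THEN conjunct1]
    by (simp add: bd_integral_lincomb distrib_left)
  then show ?thesis
    by (simp only: U[THEN conjunct2, THEN conjunct2] W[THEN conjunct2, THEN conjunct2])
qed

text \<open>Both functions admit the same weak gradient and the same trace, so the evaluations can
  differ only in the term with \<open>c\<close>, and there only on a null set.\<close>

lemma robin_form_ae_cong:
  assumes vs: "simple_polygon vs" and V: "fin_dim_subspace_H1 (polygon vs) V"
    and wd: "robin_form_well_defined vs \<kappa> c \<mu> V"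
    and "u \<in> V" "v \<in> V" "y \<in> V" and ae: "ae_eq (polygon vs) u v"
  shows "robin_form vs \<kappa> c \<mu> u y = robin_form vs \<kappa> c \<mu> v y"
proof -
  let ?P = "polygon vs" and ?M = "lebesgue_on (polygon vs)"
  note P = polygon_bounded_measurable[OF vs]
  have H1: "V \<subseteq> H1 ?P" using V by (simp add: fin_dim_subspace_H1_def)
  then obtain Gu Gy where G: "has_weak_grad ?P u Gu" "has_weak_grad ?P y Gy"
    using assms(4-6) unfolding H1_def by blast
  obtain gu gy where g: "has_trace vs u gu" "has_trace vs y gy"
    using wd[unfolded robin_form_well_defined_def, THEN conjunct1] assms(4-6) by blast
  have v: "sq_integrable ?M v" using H1 \<open>v \<in> V\<close> H1_sq_integrable by blast
  have rf: "integrable ?M (robin_integrand \<kappa> c p Gu y Gy) \<and>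
      (\<integral>x. robin_integrand \<kappa> c p Gu y Gy x \<partial>?M) + bd_integral vs (\<lambda>x. \<mu> x * gu x * gy x)
        = robin_form vs \<kappa> c \<mu> p y"
    if "p \<in> V" "has_weak_grad ?P p Gu" "has_trace vs p gu" for p
    using wd that \<open>y \<in> V\<close> G(2) g(2) unfolding robin_form_well_defined_def by blast
  note U = rf[OF \<open>u \<in> V\<close> G(1) g(1)]
    and W = rf[OF \<open>v \<in> V\<close> has_weak_grad_ae_cong[OF G(1) ae v P] has_trace_ae_cong[OF vs g(1) ae v]]
  have "(\<integral>x. robin_integrand \<kappa> c u Gu y Gy x \<partial>?M) = (\<integral>x. robin_integrand \<kappa> c v Gu y Gy x \<partial>?M)"
  proof (rule integral_cong_AE)
    show "AE x in ?M. robin_integrand \<kappa> c u Gu y Gy x = robin_integrand \<kappa> c v Gu y Gy x"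
      using ae unfolding ae_eq_def by eventually_elim (simp add: robin_integrand_def)
  qed (rule borel_measurable_integrable U[THEN conjunct1] W[THEN conjunct1])+
  then show ?thesis using U W by simp
qed

section \<open>Scalar product and norm on the domain\<close>

lemma l2_inner_lincomb:
  assumes "sq_integrable (lebesgue_on \<Omega>) u" "sq_integrable (lebesgue_on \<Omega>) v"
    "sq_integrable (lebesgue_on \<Omega>) y"
  shows "l2_inner \<Omega> (\<lambda>x. r * u x + s * v x) y = r * l2_inner \<Omega> u y + s * l2_inner \<Omega> v y"
  using sq_integrable_mult[OF assms(1,3)] sq_integrable_mult[OF assms(2,3)]
  by (simp add: l2_inner_def distrib_right mult.assoc)

lemma l2_inner_ae_cong:
  assumes "sq_integrable (lebesgue_on \<Omega>) u" "sq_integrable (lebesgue_on \<Omega>) v"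
    "sq_integrable (lebesgue_on \<Omega>) y" "ae_eq \<Omega> u v"
  shows "l2_inner \<Omega> u y = l2_inner \<Omega> v y"
  unfolding l2_inner_def
proof (rule integral_cong_AE)
  show "AE x in lebesgue_on \<Omega>. u x * y x = v x * y x"
    using assms(4) unfolding ae_eq_def by eventually_elim simp
qed (rule borel_measurable_integrable sq_integrable_mult assms)+

lemma l2_inner_self_nonneg: "0 \<le> l2_inner \<Omega> u u"
  unfolding l2_inner_def by (rule Bochner_Integration.integral_nonneg) (rule zero_le_square)

lemma l2_norm_nonneg: "0 \<le> l2_norm \<Omega> u"
  unfolding l2_norm_def by (rule real_sqrt_ge_zero[OF l2_inner_self_nonneg])

lemma l2_norm_sq: "(l2_norm \<Omega> u)\<^sup>2 = l2_inner \<Omega> u u"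
  unfolding l2_norm_def by (rule real_sqrt_pow2[OF l2_inner_self_nonneg])

text \<open>Young's inequality \<open>2vu \<le> q u\<^sup>2 + v\<^sup>2 / q\<close> replaces Cauchy--Schwarz here.\<close>

lemma l2_norm_le_of_coercive:
  assumes u: "sq_integrable (lebesgue_on \<Omega>) u" and v: "sq_integrable (lebesgue_on \<Omega>) v"
    and q: "0 < q" and le: "q * (l2_norm \<Omega> u)\<^sup>2 \<le> l2_inner \<Omega> v u"
  shows "q * l2_norm \<Omega> u \<le> l2_norm \<Omega> v"
proof -
  note i = sq_integrable_mult[OF u u] sq_integrable_mult[OF v v] sq_integrable_mult[OF v u]
  have young: "2 * q * (b * a) \<le> q\<^sup>2 * (a * a) + b * b" for a b :: real
    using zero_le_power2[of "q * a - b"] by (simp add: power2_eq_square algebra_simps)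
  have "(\<integral>x. 2 * q * (v x * u x) \<partial>lebesgue_on \<Omega>)
      \<le> (\<integral>x. q\<^sup>2 * (u x * u x) + v x * v x \<partial>lebesgue_on \<Omega>)"
    by (rule integral_mono) (use i young in auto)
  then have "2 * q * l2_inner \<Omega> v u \<le> q\<^sup>2 * (l2_norm \<Omega> u)\<^sup>2 + (l2_norm \<Omega> v)\<^sup>2"
    using i by (simp add: l2_norm_sq l2_inner_def)
  \<comment> \<open>Together with the previous bound this gives \<open>2 * q\<^sup>2\<close> times
    the square of the norm of \<open>u\<close> on the left and \<open>q\<^sup>2\<close> times it on
    the right; one copy cancels.\<close>
  moreover have "2 * q * (q * (l2_norm \<Omega> u)\<^sup>2) \<le> 2 * q * l2_inner \<Omega> v u"
    using le q by (intro mult_left_mono) auto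
  ultimately have "(q * l2_norm \<Omega> u)\<^sup>2 \<le> (l2_norm \<Omega> v)\<^sup>2"
    by (simp add: power_mult_distrib power2_eq_square algebra_simps)
  then show ?thesis
    by (rule power2_le_imp_le) (rule l2_norm_nonneg)
qed

section \<open>Contraction and convergence of the iteration\<close>

theorem theorem2:
  fixes vs :: "(real^2) list" and \<Omega> :: "(real^2) set"
    and \<kappa> c \<mu> :: "real^2 \<Rightarrow> real" and k1 k2 \<mu>1 \<delta> T \<tau> :: real and N :: nat
    and V :: "(real^2 \<Rightarrow> real) set"
    and a :: "(real^2 \<Rightarrow> real) \<Rightarrow> (real^2 \<Rightarrow> real) \<Rightarrow> real"
    and A :: "(real^2 \<Rightarrow> real) \<Rightarrow> (real^2 \<Rightarrow> real)"
    and \<phi> \<psi> f :: "real^2 \<Rightarrow> real" and w :: "int \<Rightarrow> real^2 \<Rightarrow> real"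
    and fk :: "nat \<Rightarrow> real^2 \<Rightarrow> real" and wk :: "nat \<Rightarrow> int \<Rightarrow> real^2 \<Rightarrow> real"
  assumes "simple_polygon vs" and "\<Omega> = polygon vs"
    and "0 < k1" and "\<And>x. x \<in> \<Omega> \<Longrightarrow> k1 \<le> \<kappa> x \<and> \<kappa> x \<le> k2"
    and "\<And>x. x \<in> \<Omega> \<Longrightarrow> 0 \<le> c x"
    and "0 < \<mu>1" and "\<And>x. x \<in> frontier \<Omega> \<Longrightarrow> \<mu>1 \<le> \<mu> x"
    and "fin_dim_subspace_H1 \<Omega> V"
    and "robin_form_well_defined vs \<kappa> c \<mu> V"
    and "a = robin_form vs \<kappa> c \<mu>"
    and "induced_operator \<Omega> V a A"
    and "0 < \<delta>" and "\<And>u. u \<in> V \<Longrightarrow> \<delta> * (l2_norm \<Omega> u)\<^sup>2 \<le> a u u"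
    and "0 < T" and "1 \<le> N" and "\<tau> = T / real N"
    and "\<phi> \<in> V" and "\<psi> \<in> V"
    and "f \<in> V" and "solves_scheme \<Omega> V A \<tau> N \<phi> f w" and "ae_eq \<Omega> (w (int N)) \<psi>"
    and "\<And>k. fk k \<in> V"
    and "\<And>k. solves_scheme \<Omega> V A \<tau> N \<phi> (fk k) (wk k)"
    and "\<And>k. ae_eq \<Omega> (fk (Suc k))
               (\<lambda>x. (wk k (int N) x - wk k (int N - 1) x) / \<tau> + A \<psi> x)"
  defines "\<rho> \<equiv> (1 + \<tau> * \<delta>) powi (- int N)"
  shows "0 < \<rho> \<and> \<rho> < 1 \<and>
    (\<lambda>k. l2_norm \<Omega> (\<lambda>x. fk k x - f x)) \<longlonglongrightarrow> 0 \<and>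
    (\<forall>k. l2_norm \<Omega> (\<lambda>x. fk (Suc k) x - f x) \<le> \<rho> * l2_norm \<Omega> (\<lambda>x. fk k x - f x))"
proof -
  have vs: "simple_polygon vs" and \<Omega>: "\<Omega> = polygon vs" by fact+
  have V: "fin_dim_subspace_H1 \<Omega> V" by fact
  have \<tau>: "0 < \<tau>" using \<open>0 < T\<close> \<open>1 \<le> N\<close> \<open>\<tau> = T / real N\<close> by simp
  define q where "q = 1 + \<tau> * \<delta>"
  have q: "1 < q" using \<tau> \<open>0 < \<delta>\<close> by (simp add: q_def)
  have \<rho>: "\<rho> = inverse (q ^ N)" by (simp add: \<rho>_def q_def power_int_minus)
  \<comment> \<open>Strictness of the upper bound uses \<open>1 \<le> N\<close>; with no time step
    the factor would equal 1.\<close>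
  have \<rho>01: "0 < \<rho>" "\<rho> < 1"
    using q \<open>1 \<le> N\<close> by (auto simp: \<rho> inverse_less_1_iff one_less_power)
  have sq: "sq_integrable (lebesgue_on \<Omega>) u" if "u \<in> V" for u
    using V that H1_sq_integrable unfolding fin_dim_subspace_H1_def by blast
  have VL: "(\<lambda>x. r * u x + s * v x) \<in> V" if "u \<in> V" "v \<in> V" for r s u v
    using V that by (rule fin_dim_subspace_H1_lincomb)
  have aL: "a (\<lambda>x. r * u x + s * v x) y = r * a u y + s * a v y"
    if "u \<in> V" "v \<in> V" "y \<in> V" for r s u v y
    using robin_form_lincomb[OF vs V[unfolded \<Omega>] assms(9) that] \<open>a = robin_form vs \<kappa> c \<mu>\<close> by simp
  have a_cong: "a u y = a v y" if "u \<in> V" "v \<in> V" "y \<in> V" "ae_eq \<Omega> u v" for u v y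
    using robin_form_ae_cong[OF vs V[unfolded \<Omega>] assms(9) that(1-3)] that(4)
      \<open>a = robin_form vs \<kappa> c \<mu>\<close> \<Omega> by simp
  have iL: "l2_inner \<Omega> (\<lambda>x. r * u x + s * v x) y = r * l2_inner \<Omega> u y + s * l2_inner \<Omega> v y"
    if "u \<in> V" "v \<in> V" "y \<in> V" for r s u v y
    using that by (intro l2_inner_lincomb sq)
  have i_cong: "l2_inner \<Omega> u y = l2_inner \<Omega> v y"
    if "u \<in> V" "v \<in> V" "y \<in> V" "ae_eq \<Omega> u v" for u v y
    using that by (intro l2_inner_ae_cong sq)
  have AV: "A y \<in> V" and Aa: "v \<in> V \<Longrightarrow> l2_inner \<Omega> (A y) v = a y v" if "y \<in> V" for y v
    using \<open>induced_operator \<Omega> V a A\<close> that by (auto simp: induced_operator_def)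
  have sub1: "(\<lambda>x. u x - v x) \<in> V" if "u \<in> V" "v \<in> V" for u v
    using VL[OF that, of 1 "-1"] by simp
  have sub: "a (\<lambda>x. u x - v x) y = a u y - a v y"
    "l2_inner \<Omega> (\<lambda>x. u x - v x) y = l2_inner \<Omega> u y - l2_inner \<Omega> v y"
    if "u \<in> V" "v \<in> V" "y \<in> V" for u v y
    using aL[of u v y 1 "-1"] iL[of u v y 1 "-1"] that by simp_all
  have dq1: "(\<lambda>x. (u x - v x) / \<tau>) \<in> V" if "u \<in> V" "v \<in> V" for u v
    using VL[OF that, of "1/\<tau>" "-1/\<tau>"] by (simp add: diff_divide_distrib)
  have dq: "a (\<lambda>x. (u x - v x) / \<tau>) y = (a u y - a v y) / \<tau>"
    "l2_inner \<Omega> (\<lambda>x. (u x - v x) / \<tau>) y = (l2_inner \<Omega> u y - l2_inner \<Omega> v y) / \<tau>"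
    if "u \<in> V" "v \<in> V" "y \<in> V" for u v y
    using aL[of u v y "1/\<tau>" "-1/\<tau>"] iL[of u v y "1/\<tau>" "-1/\<tau>"] that
    by (simp_all add: diff_divide_distrib)
  \<comment> \<open>The scheme tested against \<open>v\<close>, with \<open>A\<close> replaced by
    the form. The right-hand side \<open>h\<close> and the sequence \<open>p\<close> are free, so
    the exact solution and every iterate are covered.\<close>
  have step: "l2_inner \<Omega> (\<lambda>x. (p (n + 1) x - p n x) / \<tau>) v + a (p (n + 1)) v = l2_inner \<Omega> h v"
    if "solves_scheme \<Omega> V A \<tau> N \<phi> h p" "h \<in> V" "v \<in> V" "-1 \<le> n" "n < int N" for h p v n
  proof -
    have p: "p n \<in> V" "p (n + 1) \<in> V"
      and ae: "ae_eq \<Omega> (\<lambda>x. (p (n + 1) x - p n x) / \<tau> + A (p (n + 1)) x) h"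
      using that by (auto simp: solves_scheme_def)
    note d = dq1[OF p(2,1)]
    have "l2_inner \<Omega> (\<lambda>x. (p (n + 1) x - p n x) / \<tau> + A (p (n + 1)) x) v = l2_inner \<Omega> h v"
      using VL[OF d AV[OF p(2)], of 1 1] that(2,3) ae by (intro i_cong) auto
    then show ?thesis
      using iL[OF d AV[OF p(2)] that(3), of 1 1] Aa[OF p(2) that(3)] by simp
  qed
  have contr: "l2_norm \<Omega> (\<lambda>x. fk (Suc k) x - f x) \<le> \<rho> * l2_norm \<Omega> (\<lambda>x. fk k x - f x)" for k
  proof -
    define z where "z n = (\<lambda>x. wk k n x - w n x)" for n
    \<comment> \<open>The backward quotient makes \<open>d 0\<close> reach the extra node -1, which
      is where the expanded grid enters.\<close>
    define d where "d n = (\<lambda>x. (z n x - z (n - 1) x) / \<tau>)" for n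
    \<comment> \<open>The bound \<open>k\<close> shadows the fixed iteration index, because
      \<open>g\<close> is needed at both that index and its successor.\<close>
    define g where "g k = (\<lambda>x. fk k x - f x)" for k
    note sk = \<open>solves_scheme \<Omega> V A \<tau> N \<phi> (fk k) (wk k)\<close> and s = \<open>solves_scheme \<Omega> V A \<tau> N \<phi> f w\<close>
    have wV: "wk k n \<in> V" "w n \<in> V" if "-1 \<le> n" "n \<le> int N" for n
      using sk s that by (auto simp: solves_scheme_def)
    have zV: "z n \<in> V" if "-1 \<le> n" "n \<le> int N" for n
      unfolding z_def using wV[OF that] by (intro sub1)
    have dV: "d n \<in> V" if "0 \<le> n" "n \<le> int N" for n
      unfolding d_def using zV that by (intro dq1) auto
    have gV: "g k \<in> V" for k
      unfolding g_def using \<open>\<And>k. fk k \<in> V\<close> \<open>f \<in> V\<close> by (intro sub1)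
    \<comment> \<open>Difference of the tested schemes for \<open>wk k\<close> and \<open>w\<close>:
      the error satisfies the same scheme with the time-independent right-hand side
      \<open>g k\<close>.\<close>
    have zstep: "l2_inner \<Omega> (d (n + 1)) v + a (z (n + 1)) v = l2_inner \<Omega> (g k) v"
      if n: "-1 \<le> n" "n < int N" and v: "v \<in> V" for n v
    proof -
      have ww: "wk k n \<in> V" "w n \<in> V" "wk k (n + 1) \<in> V" "w (n + 1) \<in> V"
        and zz: "z n \<in> V" "z (n + 1) \<in> V"
        using wV zV n by auto
      have "l2_inner \<Omega> (d (n + 1)) v = (l2_inner \<Omega> (z (n + 1)) v - l2_inner \<Omega> (z n) v) / \<tau>"
        using dq(2)[OF zz(2,1) v] by (simp add: d_def)
      moreover have "l2_inner \<Omega> (g k) v = l2_inner \<Omega> (fk k) v - l2_inner \<Omega> f v"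
        unfolding g_def using assms(22) \<open>f \<in> V\<close> v by (rule sub(2))
      ultimately show ?thesis
        using step[OF sk assms(22) v n] step[OF s \<open>f \<in> V\<close> v n]
          dq(2)[OF ww(3,1) v] dq(2)[OF ww(4,2) v] sub[OF ww(1,2) v] sub[OF ww(3,4) v]
        by (simp add: z_def diff_divide_distrib)
    qed
    have dstep: "q * l2_norm \<Omega> (d (n + 1)) \<le> l2_norm \<Omega> (d n)" if n: "0 \<le> n" "n < int N" for n
    proof (rule l2_norm_le_of_coercive)
      have dd: "d (n + 1) \<in> V" "d n \<in> V" using dV n by auto
      then show "sq_integrable (lebesgue_on \<Omega>) (d (n + 1))" "sq_integrable (lebesgue_on \<Omega>) (d n)"
        by (auto intro: sq)
      show "0 < q" using q by simp
      \<comment> \<open>Testing with the new quotient itself produces its squared norm together with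
        \<open>\<tau> * a ?v ?v\<close>, to which coercivity applies; their sum yields the factor
        \<open>q = 1 + \<tau> * \<delta>\<close>.\<close>
      let ?v = "d (n + 1)"
      have "\<tau> * a ?v ?v = a (z (n + 1)) ?v - a (z n) ?v"
        using dq(1)[OF zV[of "n + 1"] zV[of n] dd(1)] n \<tau> by (simp add: d_def)
      \<comment> \<open>The error equations at \<open>n\<close> and \<open>n - 1\<close> have the
        same right-hand side, which cancels. The lower one exists because \<open>0 \<le> n\<close>
        gives \<open>-1 \<le> n - 1\<close>.\<close>
      moreover have "l2_inner \<Omega> ?v ?v + a (z (n + 1)) ?v = l2_inner \<Omega> (d n) ?v + a (z n) ?v"
        using zstep[of n ?v] zstep[of "n - 1" ?v] n dd by simp
      moreover have "\<tau> * (\<delta> * (l2_norm \<Omega> ?v)\<^sup>2) \<le> \<tau> * a ?v ?v"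
        using assms(13)[OF dd(1)] \<tau> by (intro mult_left_mono) auto
      ultimately show "q * (l2_norm \<Omega> ?v)\<^sup>2 \<le> l2_inner \<Omega> (d n) ?v"
        by (simp add: q_def l2_norm_sq algebra_simps)
    qed
    \<comment> \<open>There are exactly \<open>N\<close> steps from \<open>d 0\<close> to
      \<open>d (int N)\<close>, each gaining a factor \<open>q\<close>; this is the exponent in the
      rate.\<close>
    have "q ^ n * l2_norm \<Omega> (d (int n)) \<le> l2_norm \<Omega> (d 0)" if "n \<le> N" for n
      using that
    proof (induction n)
      case (Suc n)
      have "q ^ n * (q * l2_norm \<Omega> (d (int n + 1))) \<le> q ^ n * l2_norm \<Omega> (d (int n))"
        using dstep[of "int n"] Suc.prems q by (intro mult_left_mono) auto
      with Suc show ?case by (simp add: algebra_simps)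
    qed simp
    then have dN: "l2_norm \<Omega> (d (int N)) \<le> \<rho> * l2_norm \<Omega> (d 0)"
      using q by (simp add: \<rho> field_simps)
    \<comment> \<open>The factor 1 turns the coercive estimate into a plain comparison of norms, so
      it suffices to test the identity of \<open>d 0\<close> and \<open>g k\<close> with
      \<open>d 0\<close>.\<close>
    have "1 * l2_norm \<Omega> (d 0) \<le> l2_norm \<Omega> (g k)"
    proof (rule l2_norm_le_of_coercive)
      have w0: "wk k 0 \<in> V" "w 0 \<in> V" and d0: "d 0 \<in> V" using wV dV by auto
      \<comment> \<open>The initial conditions hold only almost everywhere, so \<open>z 0\<close>
        need not be the zero function; its form value vanishes by invariance under change of
        representative.\<close>
      have "ae_eq \<Omega> (wk k 0) (w 0)"
        using sk s unfolding solves_scheme_def ae_eq_def by auto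
      then have "a (z 0) (d 0) = 0"
        using a_cong[OF w0 d0] sub(1)[OF w0 d0] by (simp add: z_def)
      then show "1 * (l2_norm \<Omega> (d 0))\<^sup>2 \<le> l2_inner \<Omega> (g k) (d 0)"
        using zstep[of "-1" "d 0"] d0 \<open>1 \<le> N\<close> by (simp add: l2_norm_sq)
    qed (use dV gV in \<open>auto intro: sq\<close>)
    \<comment> \<open>Subtracting the last equation of the exact scheme, at
      \<open>n = N - 1\<close>, from the update rule leaves \<open>d (int N)\<close>: the terms with
      \<open>\<psi>\<close> and \<open>w (int N)\<close> cancel since these agree almost
      everywhere.\<close>
    moreover have "1 * l2_norm \<Omega> (g (Suc k)) \<le> l2_norm \<Omega> (d (int N))"
    proof (rule l2_norm_le_of_coercive)
      let ?v = "g (Suc k)" and ?e = "\<lambda>x. (wk k (int N) x - wk k (int N - 1) x) / \<tau>"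
      note v = gV[of "Suc k"]
      have ww: "wk k (int N) \<in> V" "wk k (int N - 1) \<in> V" "w (int N) \<in> V" "w (int N - 1) \<in> V"
        using wV \<open>1 \<le> N\<close> by auto
      have zz: "z (int N) \<in> V" "z (int N - 1) \<in> V" using zV \<open>1 \<le> N\<close> by auto
      note e = dq1[OF ww(1,2)] and A\<psi> = AV[OF \<open>\<psi> \<in> V\<close>]
      have "l2_inner \<Omega> (fk (Suc k)) ?v = l2_inner \<Omega> (\<lambda>x. ?e x + A \<psi> x) ?v"
        using VL[OF e A\<psi>, of 1 1] v assms(22) assms(24)[of k] by (intro i_cong) auto
      also have "\<dots> = l2_inner \<Omega> ?e ?v + a \<psi> ?v"
        using iL[OF e A\<psi> v, of 1 1] Aa[OF \<open>\<psi> \<in> V\<close> v] by simp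
      finally have "l2_inner \<Omega> (fk (Suc k)) ?v = l2_inner \<Omega> ?e ?v + a \<psi> ?v" .
      moreover have "l2_inner \<Omega> (\<lambda>x. (w (int N) x - w (int N - 1) x) / \<tau>) ?v + a (w (int N)) ?v
          = l2_inner \<Omega> f ?v"
        using step[OF s \<open>f \<in> V\<close> v, of "int N - 1"] by simp
      moreover have "a (w (int N)) ?v = a \<psi> ?v"
        using ww(3) \<open>\<psi> \<in> V\<close> v \<open>ae_eq \<Omega> (w (int N)) \<psi>\<close> by (rule a_cong)
      moreover have "l2_inner \<Omega> ?v ?v = l2_inner \<Omega> (fk (Suc k)) ?v - l2_inner \<Omega> f ?v"
        using sub(2)[OF assms(22)[of "Suc k"] \<open>f \<in> V\<close> v] by (simp add: g_def)
      moreover have "l2_inner \<Omega> (d (int N)) ?v = l2_inner \<Omega> ?e ?v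
          - l2_inner \<Omega> (\<lambda>x. (w (int N) x - w (int N - 1) x) / \<tau>) ?v"
        using dq(2)[OF zz v] dq(2)[OF ww(1,2) v] dq(2)[OF ww(3,4) v]
          sub(2)[OF ww(1,3) v] sub(2)[OF ww(2,4) v]
        by (simp add: d_def z_def diff_divide_distrib)
      ultimately show "1 * (l2_norm \<Omega> ?v)\<^sup>2 \<le> l2_inner \<Omega> (d (int N)) ?v"
        by (simp add: l2_norm_sq)
    qed (use dV gV in \<open>auto intro: sq\<close>)
    \<comment> \<open>The chain passes from \<open>g (Suc k)\<close> to \<open>d (int N)\<close>,
      then with factor \<open>\<rho>\<close> to \<open>d 0\<close>, and from there to
      \<open>g k\<close>.\<close>
    ultimately show ?thesis
      using dN \<rho>01(1) mult_left_mono[of "l2_norm \<Omega> (d 0)" "l2_norm \<Omega> (g k)" \<rho>]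
      unfolding g_def by linarith
  qed

  \<comment> \<open>Geometric decay and passage to the limit\<close>
  have geom: "l2_norm \<Omega> (\<lambda>x. fk k x - f x) \<le> \<rho> ^ k * l2_norm \<Omega> (\<lambda>x. fk 0 x - f x)" for k
  proof (induction k)
    case (Suc k)
    have "\<rho> * l2_norm \<Omega> (\<lambda>x. fk k x - f x) \<le> \<rho> * (\<rho> ^ k * l2_norm \<Omega> (\<lambda>x. fk 0 x - f x))"
      using Suc \<rho>01 by (intro mult_left_mono) auto
    with contr[of k] show ?case by (simp add: mult.assoc)
  qed simp
  have lim: "(\<lambda>k. \<rho> ^ k * l2_norm \<Omega> (\<lambda>x. fk 0 x - f x)) \<longlonglongrightarrow> 0"
    using \<rho>01 by (intro tendsto_mult_left_zero LIMSEQ_power_zero) simp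
  have "(\<lambda>k. l2_norm \<Omega> (\<lambda>x. fk k x - f x)) \<longlonglongrightarrow> 0"
    by (rule tendsto_sandwich[OF _ _ tendsto_const lim])
       (intro always_eventually allI l2_norm_nonneg geom)+
  with contr \<rho>01 show ?thesis by blast
qed

end
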